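(* Let $F_t=\{t f_i(x)+q_i : 1\le i\le N\}$ be a semi-linear, but not linear, one-parameter similarity family on $\mathbb{R}^d$. Let $\rho$ be the maximum scaling ratio of the similarities in $F=\{f_1,\dots,f_N\}$, let $\widehat F=\{\widehat f_1,\dots,\widehat f_{\widehat N}\}$ be the subset of $F$ consisting of those similarities with scaling ratio $\rho$, and let $\widehat F_t=\{t\widehat f_i(x)+\widehat q_i : 1\le i\le \widehat N\}$ be the corresponding subset of $F_t$. Let $H_t$ be any subset of $\widehat F_t$ having the property that the $\widehat q_i$ are all equal, i.e. $H_t$ has the form $H_t=\{t h_i(x)+q_0 : 1\le i\le k\}$ for some $q_0\in\mathbb{R}^d$. If the orbit of a point on the unit sphere centered at $q_0$ under the action of the set $H_{t_0}$ of isometries is dense on this unit sphere, then there is a $\tau<t_0$ such that the attractor $A_t$ of $F_t$ has non-empty interior for all $t\in(\tau,t_0)$.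
   Context: A function $f:\mathbb{R}^d\to\mathbb{R}^d$ is affine if $f(x)=Lx+a$, where $L$ is a non-singular $d\times d$ real matrix (the linear part of $f$) and $a\in\mathbb{R}^d$. A one-parameter affine family is given by $N\ge 2$ affine functions $F=\{f_1,\dots,f_N\}$ on $\mathbb{R}^d$ and vectors $q_1,\dots,q_N\in\mathbb{R}^d$; for each real $t\ge 0$ it is $F_t=\{f_{(i,t)} : 1\le i\le N\}$ with $f_{(i,t)}(x)=t f_i(x)+q_i$. It is a similarity family if each function is a similarity transformation. The Hutchinson operator of $F_t$ on non-empty compact sets is $F_t(K)=\bigcup_{f\in F_t} f(K)$. A non-empty compact set $A_t$ is the attractor of $F_t$ if $A_t=\lim_{k\to\infty}F_t^k(K)$ in the Hausdorff metric for every non-empty compact $K$. If $L_1,\dots,L_N$ are the linear parts of $f_1,\dots,f_N$, the joint spectral radius of $F$ is $\rho(F)=\limsup_{k\to\infty}\big(\max\|L_{i_1}\cdots L_{i_k}\|\big)^{1/k}$, the maximum being over all words of length $k$ in $\{1,\dots,N\}$. Set $t_0=1/\rho(F)$; the attractor $A_t$ exists exactly for $t\in[0,t_0)$. For a similarity family, $\rho(F)$ is the maximum of the scaling ratios of $f_1,\dots,f_N$. Functions $f,g$ on $\mathbb{R}^d$ are conjugate by a function $h$ if $g=h^{-1}fh$. The family $F_t$ is linear if, for all $i$ and all $t\in[0,t_0)$, $f_{(i,t)}$ is conjugate to a linear function by a function $h$ independent of $i$ and $t$; it is semi-linear if, for all $i$ and all $t\in[0,t_0)$, $f_{(i,t)}$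 is conjugate to a linear function by a function $h_i$ independent of $t$. Each function in $\widehat F_{t_0}$ is an isometry, and $t_0\widehat f_i(x)+\widehat q_i$ has fixed point $\widehat q_i$. The orbit of a point under the action of a set of isometries is the set of all images of the point under finite compositions of elements of the set. *)

theory Defs
  imports "HOL-Analysis.Analysis"
begin

definition affine_function :: "(real ^ 'n \<Rightarrow> real ^ 'n) \<Rightarrow> bool" where
  "affine_function f \<longleftrightarrow>
     (\<exists>(L :: real ^ 'n ^ 'n) a. invertible L \<and> (\<forall>x. f x = L *v x + a))"

definition linear_part :: "(real ^ 'n \<Rightarrow> real ^ 'n) \<Rightarrow> real ^ 'n ^ 'n" where
  "linear_part f = (THE L. \<exists>a. \<forall>x. f x = L *v x + a)"

definition similarity_with_ratio :: "real \<Rightarrow> (real ^ 'n \<Rightarrow> real ^ 'n) \<Rightarrow> bool" where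
  "similarity_with_ratio r f \<longleftrightarrow> r > 0 \<and> (\<forall>x y. dist (f x) (f y) = r * dist x y)"

definition scaling_ratio :: "(real ^ 'n \<Rightarrow> real ^ 'n) \<Rightarrow> real" where
  "scaling_ratio f = (THE r. similarity_with_ratio r f)"

definition affine_family ::
    "nat \<Rightarrow> (nat \<Rightarrow> real ^ 'n \<Rightarrow> real ^ 'n) \<Rightarrow> bool" where
  "affine_family N f \<longleftrightarrow> N \<ge> 2 \<and> (\<forall>i\<in>{1..N}. affine_function (f i))"

definition similarity_family ::
    "nat \<Rightarrow> (nat \<Rightarrow> real ^ 'n \<Rightarrow> real ^ 'n) \<Rightarrow> bool" where
  "similarity_family N f \<longleftrightarrow>
     affine_family N f \<and> (\<forall>i\<in>{1..N}. \<exists>r. similarity_with_ratio r (f i))"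

definition family_map ::
    "(nat \<Rightarrow> real ^ 'n \<Rightarrow> real ^ 'n) \<Rightarrow> (nat \<Rightarrow> real ^ 'n) \<Rightarrow> real \<Rightarrow> nat \<Rightarrow>
       real ^ 'n \<Rightarrow> real ^ 'n" where
  "family_map f q t i = (\<lambda>x. t *\<^sub>R f i x + q i)"

definition family_at ::
    "nat \<Rightarrow> (nat \<Rightarrow> real ^ 'n \<Rightarrow> real ^ 'n) \<Rightarrow> (nat \<Rightarrow> real ^ 'n) \<Rightarrow> real \<Rightarrow>
       (real ^ 'n \<Rightarrow> real ^ 'n) set" where
  "family_at N f q t = family_map f q t ` {1..N}"

definition hutchinson :: "('a \<Rightarrow> 'a) set \<Rightarrow> 'a set \<Rightarrow> 'a set" where
  "hutchinson \<Phi> K = (\<Union>g\<in>\<Phi>. g ` K)"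

text \<open>Meaningful for non-empty bounded sets only.\<close>

definition hausdorff_dist :: "'a::metric_space set \<Rightarrow> 'a set \<Rightarrow> real" where
  "hausdorff_dist A B = max (SUP x\<in>A. infdist x B) (SUP y\<in>B. infdist y A)"

definition is_attractor :: "('a::metric_space \<Rightarrow> 'a) set \<Rightarrow> 'a set \<Rightarrow> bool" where
  "is_attractor \<Phi> A \<longleftrightarrow> compact A \<and> A \<noteq> {} \<and>
     (\<forall>K. compact K \<and> K \<noteq> {} \<longrightarrow>
        (\<lambda>k. hausdorff_dist ((hutchinson \<Phi> ^^ k) K) A) \<longlonglongrightarrow> 0)"

text \<open>The matrix product along a word (a list of indices).  The operator norm is used for
  the joint spectral radius, whose value does not depend on the choice of a matrix norm.
  The term at \<open>k = 0\<close> is irrelevant to the limit superior.\<close>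

definition word_product ::
    "(nat \<Rightarrow> real ^ 'n \<Rightarrow> real ^ 'n) \<Rightarrow> nat list \<Rightarrow> real ^ 'n ^ 'n" where
  "word_product f w = foldr (\<lambda>i M. linear_part (f i) ** M) w (mat 1)"

definition joint_spectral_radius ::
    "nat \<Rightarrow> (nat \<Rightarrow> real ^ 'n \<Rightarrow> real ^ 'n) \<Rightarrow> real" where
  "joint_spectral_radius N f = real_of_ereal (limsup (\<lambda>k. ereal
     (root k (Max ((\<lambda>w. onorm ((*v) (word_product f w))) `
        {w. length w = k \<and> set w \<subseteq> {1..N}})))))"

definition critical_parameter ::
    "nat \<Rightarrow> (nat \<Rightarrow> real ^ 'n \<Rightarrow> real ^ 'n) \<Rightarrow> real" where
  "critical_parameter N f = 1 / joint_spectral_radius N f"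

definition conjugate_by :: "('a \<Rightarrow> 'a) \<Rightarrow> ('a \<Rightarrow> 'a) \<Rightarrow> ('a \<Rightarrow> 'a) \<Rightarrow> bool" where
  "conjugate_by h f g \<longleftrightarrow> bij h \<and> g = inv h \<circ> f \<circ> h"

text \<open>At \<open>t = 0\<close> the maps of a family are constant, so the linear functions below must be
  allowed to be singular.\<close>

definition linear_family ::
    "nat \<Rightarrow> (nat \<Rightarrow> real ^ 'n \<Rightarrow> real ^ 'n) \<Rightarrow> (nat \<Rightarrow> real ^ 'n) \<Rightarrow> bool" where
  "linear_family N f q \<longleftrightarrow>
     (\<exists>h. \<forall>i\<in>{1..N}. \<forall>t\<in>{0..<critical_parameter N f}.
        \<exists>g. linear g \<and> conjugate_by h (family_map f q t i) g)"

definition semi_linear_family ::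
    "nat \<Rightarrow> (nat \<Rightarrow> real ^ 'n \<Rightarrow> real ^ 'n) \<Rightarrow> (nat \<Rightarrow> real ^ 'n) \<Rightarrow> bool" where
  "semi_linear_family N f q \<longleftrightarrow>
     (\<forall>i\<in>{1..N}. \<exists>h. \<forall>t\<in>{0..<critical_parameter N f}.
        \<exists>g. linear g \<and> conjugate_by h (family_map f q t i) g)"

text \<open>The empty composition is included, so a point belongs to its own orbit.\<close>

inductive_set orbit_under :: "('a \<Rightarrow> 'a) set \<Rightarrow> 'a \<Rightarrow> 'a set"
  for S :: "('a \<Rightarrow> 'a) set" and x :: 'a where
  base: "x \<in> orbit_under S x"
| step: "y \<in> orbit_under S x \<Longrightarrow> g \<in> S \<Longrightarrow> g y \<in> orbit_under S x"

end

theory Submission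
  imports Defs
begin

text \<open>
  Semi-linearity at \<open>t = 0\<close>, where the maps are constant, forces the conjugating bijection
  \<open>h\<^sub>i\<close> to send \<open>0\<close> to \<open>q\<^sub>i\<close>; any \<open>t > 0\<close> then shows that \<open>q\<^sub>i\<close> is a fixed point, so
  \<open>f\<^sub>i q\<^sub>i = 0\<close> and the map with index \<open>i\<close> is \<open>x \<mapsto> q\<^sub>i + t L\<^sub>i (x - q\<^sub>i)\<close>. If all centres \<open>q\<^sub>i\<close>
  agreed, a translation would conjugate the whole family to linear maps; hence some \<open>q\<^sub>i\<close> differs
  from \<open>q\<^sub>0\<close>. For similarities the joint spectral radius is the largest ratio, so
  \<open>t\<^sub>0 = 1 / \<rho>\<close>. Put \<open>s = t / t\<^sub>0\<close> and move \<open>q\<^sub>0\<close> to the origin: the maps indexed by \<open>J\<close> become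
  \<open>v \<mapsto> s B\<^sub>j v\<close> with \<open>B\<^sub>j\<close> orthogonal, and the map with the other centre becomes
  \<open>g v = u + s L (v - u)\<close>, where \<open>u \<noteq> 0\<close> and \<open>L\<close> has ratio \<open>c \<le> 1\<close>.

  A set that is covered by its own images lies in the attractor
  (\<open>attractor_contains_self_covered_set\<close>), so it suffices to find a ball \<open>U\<close> of radius \<open>R\<close> about
  the origin that is covered by images of itself under finite compositions of the maps
  (\<open>ball_covered_by_images\<close>). A single map \<open>s B\<^sub>j\<close> covers the concentric ball of radius \<open>s R\<close>.
  The remaining shell is reached by \<open>g U\<close>, a ball of radius \<open>s c R\<close> about
  \<open>p = u - s L u\<close>, if its farthest points from the origin lie beyond \<open>U\<close> and it is then turned
  in all directions by words in the maps \<open>s B\<^sub>j\<close>.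

  Turning costs contraction: a word of length \<open>k\<close> shrinks by \<open>s ^ k\<close>. Recurrence of isometries of
  a compact set and compactness turn the dense orbit into a bound \<open>M\<close>, depending only on the
  angular precision, such that words of length at most \<open>M\<close> take every direction near every other
  (\<open>dense_orbit_uniformly_transitive\<close>). With \<open>M\<close> fixed, the loss \<open>1 - s ^ M\<close> is of order
  \<open>M (1 - s)\<close>, relative to \<open>R\<close>. The farthest points of \<open>g U\<close> exceed \<open>U\<close> by
  \<open>\<bar>p\<bar> - (1 - s c) R\<close>. For \<open>R = \<beta> \<bar>p\<bar> / (1 - s c)\<close> this is \<open>(1 / \<beta> - 1) (1 - s c) R\<close>, which is at
  least of the same order, so a suitable \<open>\<beta>\<close> makes it win for all \<open>s\<close> near \<open>1\<close>
  (\<open>covering_parameters\<close>). Here \<open>p \<noteq> 0\<close> because \<open>\<bar>p\<bar> \<ge> (1 - s c) \<bar>u\<bar>\<close>.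
\<close>

section \<open>Attractors of contracting systems\<close>

lemma foldr_hutchinson_funpow:
  "y \<in> (hutchinson \<Phi> ^^ k) K \<longleftrightarrow>
     (\<exists>w z. length w = k \<and> set w \<subseteq> \<Phi> \<and> z \<in> K \<and> y = foldr (\<lambda>g. g) w z)"
proof (induction k arbitrary: y)
  case 0
  then show ?case by simp
next
  case (Suc k)
  have "y \<in> (hutchinson \<Phi> ^^ Suc k) K \<longleftrightarrow> (\<exists>g\<in>\<Phi>. \<exists>y'\<in>(hutchinson \<Phi> ^^ k) K. y = g y')"
    by (auto simp: hutchinson_def)
  also have "\<dots> \<longleftrightarrow> (\<exists>g\<in>\<Phi>. \<exists>w z. length w = k \<and> set w \<subseteq> \<Phi> \<and> z \<in> K \<and> y = g (foldr (\<lambda>g. g) w z))"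
    unfolding Bex_def Suc by blast
  also have "\<dots> \<longleftrightarrow> (\<exists>w z. length w = Suc k \<and> set w \<subseteq> \<Phi> \<and> z \<in> K \<and> y = foldr (\<lambda>g. g) w z)"
    (is "?l \<longleftrightarrow> ?r")
  proof
    assume ?l
    then obtain g w z where "g \<in> \<Phi>" "length w = k" "set w \<subseteq> \<Phi>" "z \<in> K" "y = g (foldr (\<lambda>g. g) w z)"
      by blast
    then show ?r by (intro exI[of _ "g # w"] exI[of _ z]) auto
  next
    assume ?r
    then obtain w z where w: "length w = Suc k" "set w \<subseteq> \<Phi>" "z \<in> K" "y = foldr (\<lambda>g. g) w z"
      by blast
    then obtain g w' where "w = g # w'" by (cases w) auto
    with w show ?l by auto
  qed
  finally show ?case .
qed

lemma dist_foldr_contractions: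
  fixes \<Phi> :: "('a::metric_space \<Rightarrow> 'a) set"
  assumes "\<And>g x y. g \<in> \<Phi> \<Longrightarrow> dist (g x) (g y) \<le> s * dist x y" "0 \<le> s" "set w \<subseteq> \<Phi>"
  shows "dist (foldr (\<lambda>g. g) w x) (foldr (\<lambda>g. g) w y) \<le> s ^ length w * dist x y"
  using assms(3)
proof (induction w)
  case Nil
  then show ?case by simp
next
  case (Cons g w)
  have "dist (foldr (\<lambda>g. g) (g # w) x) (foldr (\<lambda>g. g) (g # w) y)
      \<le> s * dist (foldr (\<lambda>g. g) w x) (foldr (\<lambda>g. g) w y)"
    using Cons.prems assms(1) by simp
  also have "\<dots> \<le> s * (s ^ length w * dist x y)"
    using Cons assms(2) by (intro mult_left_mono) auto
  finally show ?case by (simp add: mult_ac)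
qed

lemma hausdorff_dist_bounds:
  assumes "A \<noteq> {}" "B \<noteq> {}"
    and "\<And>x. x \<in> A \<Longrightarrow> infdist x B \<le> c" "\<And>y. y \<in> B \<Longrightarrow> infdist y A \<le> c"
  shows "0 \<le> hausdorff_dist A B" "hausdorff_dist A B \<le> c"
proof -
  obtain x where x: "x \<in> A" using assms by blast
  have "infdist x B \<le> (SUP x\<in>A. infdist x B)"
    by (rule cSUP_upper[OF x]) (use assms in \<open>auto intro!: bdd_aboveI2\<close>)
  then show "0 \<le> hausdorff_dist A B"
    unfolding hausdorff_dist_def using infdist_nonneg[of x B] by linarith
  show "hausdorff_dist A B \<le> c"
    unfolding hausdorff_dist_def by (intro max.boundedI cSUP_least assms)
qed

text \<open>
  Hutchinson's estimate: applying one and the same word of length \<open>k\<close> to a point of \<open>K\<close> and to a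
  point of \<open>A\<close> gives points at distance at most \<open>s ^ k\<close> times the diameter of \<open>A \<union> K\<close>. Invariance
  of \<open>A\<close> makes all of \<open>A\<close> arise as images of points of \<open>A\<close> under such words.
\<close>

lemma invariant_compact_is_attractor:
  fixes \<Phi> :: "('a::metric_space \<Rightarrow> 'a) set"
  assumes contr: "\<And>g x y. g \<in> \<Phi> \<Longrightarrow> dist (g x) (g y) \<le> s * dist x y" and s: "0 \<le> s" "s < 1"
    and A: "compact A" "A \<noteq> {}" "hutchinson \<Phi> A = A"
  shows "is_attractor \<Phi> A"
  unfolding is_attractor_def
proof (intro conjI allI impI)
  fix K :: "'a set" assume K: "compact K \<and> K \<noteq> {}"
  let ?W = "\<lambda>w. foldr (\<lambda>g. g) w"
  obtain a0 where a0: "a0 \<in> A" using A by blast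
  obtain z0 where z0: "z0 \<in> K" using K by blast
  obtain D where D: "\<And>x y. x \<in> A \<union> K \<Longrightarrow> y \<in> A \<union> K \<Longrightarrow> dist x y \<le> D"
    using compact_imp_bounded[OF compact_Un[OF A(1)], of K] K
    unfolding bounded_two_points by blast
  have fix_A: "(hutchinson \<Phi> ^^ k) A = A" for k
    by (induction k) (use A(3) in auto)
  have \<Phi>: "\<Phi> \<noteq> {}" using A by (auto simp: hutchinson_def)
  have bound: "0 \<le> hausdorff_dist ((hutchinson \<Phi> ^^ k) K) A \<and>
      hausdorff_dist ((hutchinson \<Phi> ^^ k) K) A \<le> s ^ k * D" for k
  proof -
    have close: "dist (?W w x) (?W w y) \<le> s ^ k * D"
      if "length w = k" "set w \<subseteq> \<Phi>" "x \<in> A \<union> K" "y \<in> A \<union> K" for w x y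
      using dist_foldr_contractions[of \<Phi> s w x y, OF contr s(1)] D[of x y] that s
      by (meson mult_left_mono order_trans zero_le_power)
    have "infdist y A \<le> s ^ k * D" if y: "y \<in> (hutchinson \<Phi> ^^ k) K" for y
    proof -
      obtain w z where w: "length w = k" "set w \<subseteq> \<Phi>" "z \<in> K" "y = ?W w z"
        using y foldr_hutchinson_funpow[of y k \<Phi> K] by blast
      have "?W w a0 \<in> A" using foldr_hutchinson_funpow[of "?W w a0" k \<Phi> A] fix_A a0 w by blast
      then show ?thesis using close[of w z a0] w a0 by (auto intro: infdist_le2)
    qed
    moreover have "infdist a ((hutchinson \<Phi> ^^ k) K) \<le> s ^ k * D" if a: "a \<in> A" for a
    proof -
      obtain w z where w: "length w = k" "set w \<subseteq> \<Phi>" "z \<in> A" "a = ?W w z"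
        using a fix_A foldr_hutchinson_funpow[of a k \<Phi> A] by blast
      have "?W w z0 \<in> (hutchinson \<Phi> ^^ k) K"
        using foldr_hutchinson_funpow[of "?W w z0" k \<Phi> K] z0 w by blast
      then show ?thesis using close[of w z z0] w z0 by (auto intro: infdist_le2)
    qed
    moreover have "(hutchinson \<Phi> ^^ k) K \<noteq> {}"
      by (induction k) (use K \<Phi> in \<open>auto simp: hutchinson_def\<close>)
    ultimately show ?thesis using hausdorff_dist_bounds[OF _ A(2)] by blast
  qed
  have "(\<lambda>k. s ^ k * D) \<longlonglongrightarrow> 0"
    using tendsto_mult_right[OF LIMSEQ_power_zero[of s], of D] s by simp
  then show "(\<lambda>k. hausdorff_dist ((hutchinson \<Phi> ^^ k) K) A) \<longlonglongrightarrow> 0"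
    by (rule tendsto_sandwich[rotated 3]) (use bound in auto)
qed (use A in auto)

text \<open>
  The attractor is obtained as the greatest subset of \<open>K\<close> covered by its own images, in the manner
  of Knaster and Tarski. It is closed because its closure is again covered by its own images, and
  it contains \<open>X\<close>, one of the sets of which it is the union.
\<close>

lemma attractor_contains_self_covered_set:
  fixes \<Phi> :: "('a::metric_space \<Rightarrow> 'a) set"
  assumes fin: "finite \<Phi>"
    and contr: "\<And>g x y. g \<in> \<Phi> \<Longrightarrow> dist (g x) (g y) \<le> s * dist x y" and s: "0 \<le> s" "s < 1"
    and K: "compact K" "hutchinson \<Phi> K \<subseteq> K"
    and X: "X \<noteq> {}" "X \<subseteq> K" "X \<subseteq> hutchinson \<Phi> X"
  shows "\<exists>A. is_attractor \<Phi> A \<and> X \<subseteq> A"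
proof -
  define A where "A = \<Union> {Y. Y \<subseteq> K \<and> Y \<subseteq> hutchinson \<Phi> Y}"
  have mono: "hutchinson \<Phi> Y \<subseteq> hutchinson \<Phi> Z" if "Y \<subseteq> Z" for Y Z
    using that by (auto simp: hutchinson_def)
  have largest: "Y \<subseteq> A" if "Y \<subseteq> K" "Y \<subseteq> hutchinson \<Phi> Y" for Y
    using that by (auto simp: A_def)
  have AK: "A \<subseteq> K" by (auto simp: A_def)
  have A1: "A \<subseteq> hutchinson \<Phi> A"
  proof
    fix y assume "y \<in> A"
    then obtain Y where Y: "y \<in> Y" "Y \<subseteq> K" "Y \<subseteq> hutchinson \<Phi> Y" by (auto simp: A_def)
    with mono[OF largest[OF Y(2,3)]] show "y \<in> hutchinson \<Phi> A" by blast
  qed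
  have A2: "hutchinson \<Phi> A \<subseteq> A"
    by (rule largest) (use mono[OF AK] K mono[OF A1] in auto)
  have clK: "closure A \<subseteq> K" using AK K by (simp add: closure_minimal compact_imp_closed)
  then have ccl: "compact (closure A)" using K(1)
    by (metis closed_closure closed_Int_compact inf.absorb1)
  have cont: "continuous_on S g" if "g \<in> \<Phi>" for g S
  proof (rule continuous_on_subset[OF lipschitz_on_continuous_on])
    show "s-lipschitz_on UNIV g" using contr[OF that] s by (auto intro: lipschitz_onI)
  qed simp
  have "compact (hutchinson \<Phi> (closure A))"
    unfolding hutchinson_def using fin ccl cont by (intro compact_UN compact_continuous_image)
  then have "closure A \<subseteq> hutchinson \<Phi> (closure A)"
    using A1 mono[OF closure_subset[of A]]
    by (intro closure_minimal) (auto intro: compact_imp_closed)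
  then have "closure A \<subseteq> A" using largest clK by blast
  then have "compact A" using ccl closure_subset[of A] by (metis subset_antisym)
  moreover have "X \<subseteq> A" using largest X by blast
  ultimately show ?thesis
    using invariant_compact_is_attractor[of \<Phi> s A] contr s A1 A2 X by blast
qed

section \<open>Dense orbits of isometries\<close>

lemma dist_foldr_isometries:
  fixes B :: "'i \<Rightarrow> 'a::metric_space \<Rightarrow> 'a"
  assumes "\<And>j x y. j \<in> J \<Longrightarrow> dist (B j x) (B j y) = dist x y" "set w \<subseteq> J"
  shows "dist (foldr B w x) (foldr B w y) = dist x y"
  using assms(2) by (induction w) (auto simp: assms(1))

text \<open>
  The iterates of \<open>x\<close> have a convergent subsequence, so two of them, say the \<open>m\<close>-th and the
  \<open>(m + n)\<close>-th, are close; since \<open>h ^^ m\<close> preserves distances, \<open>x\<close> and its \<open>n\<close>-th iterate are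
  equally close.
\<close>

lemma isometry_recurrent:
  fixes h :: "'a::metric_space \<Rightarrow> 'a"
  assumes iso: "\<And>x y. dist (h x) (h y) = dist x y" and K: "compact K" "h ` K \<subseteq> K" "x \<in> K" and e: "0 < e"
  shows "\<exists>n>0. dist ((h ^^ n) x) x < e"
proof -
  have iso_n: "dist ((h ^^ n) y) ((h ^^ n) z) = dist y z" for n y z
    by (induction n) (auto simp: iso)
  have "(h ^^ n) x \<in> K" for n
    by (induction n) (use K in auto)
  then obtain l r where r: "strict_mono r" "((\<lambda>n. (h ^^ n) x) \<circ> r) \<longlonglongrightarrow> l"
    using K(1) unfolding compact_def by metis
  have "Cauchy ((\<lambda>n. (h ^^ n) x) \<circ> r)" using r(2) by (rule LIMSEQ_imp_Cauchy)
  then obtain M where M: "\<And>m n. m \<ge> M \<Longrightarrow> n \<ge> M \<Longrightarrow> dist ((h ^^ r m) x) ((h ^^ r n) x) < e"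
    using e unfolding Cauchy_def by (metis comp_apply)
  define k where "k = r (Suc M) - r M"
  have k: "k > 0" "r (Suc M) = r M + k"
    using strict_monoD[OF r(1), of M "Suc M"] by (auto simp: k_def)
  have "dist ((h ^^ r (Suc M)) x) ((h ^^ r M) x) = dist ((h ^^ k) x) x"
    by (simp add: k(2) funpow_add iso_n)
  with M[of "Suc M" M] k(1) show ?thesis by force
qed

lemma foldr_in_invariant:
  assumes "\<And>j. j \<in> J \<Longrightarrow> B j ` K \<subseteq> K" "set w \<subseteq> J" "x \<in> K"
  shows "foldr B w x \<in> K"
  using assms(2,3) by (induction w) (use assms(1) in \<open>auto\<close>)

text \<open>
  To go from \<open>y\<close> to \<open>z\<close>, both approximated by the orbit of \<open>x\<close>, one has to travel from \<open>y\<close> back to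
  \<open>x\<close>, although the inverse maps are not available. Recurrence supplies a substitute: if
  \<open>a\<close> takes \<open>x\<close> near \<open>y\<close> and \<open>a ^ n\<close> takes \<open>x\<close> near itself, then \<open>a ^ (n - 1)\<close> takes \<open>y\<close> near \<open>x\<close>.
  The bound \<open>M\<close> on the length comes from a finite net of \<open>K\<close>.
\<close>

lemma dense_orbit_uniformly_transitive:
  fixes B :: "'i \<Rightarrow> 'a::metric_space \<Rightarrow> 'a"
  assumes iso: "\<And>j x y. j \<in> J \<Longrightarrow> dist (B j x) (B j y) = dist x y"
    and inv: "\<And>j. j \<in> J \<Longrightarrow> B j ` K \<subseteq> K" and K: "compact K" and x: "x \<in> K"
    and dense: "\<And>y e. y \<in> K \<Longrightarrow> 0 < e \<Longrightarrow> \<exists>w. set w \<subseteq> J \<and> dist (foldr B w x) y < e"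
    and e: "0 < e"
  shows "\<exists>M. \<forall>y\<in>K. \<forall>z\<in>K. \<exists>w. set w \<subseteq> J \<and> length w \<le> M \<and> dist (foldr B w y) z < e"
proof -
  define \<delta> where "\<delta> = e / 4"
  have \<delta>: "\<delta> > 0" "e = 4 * \<delta>" using e by (auto simp: \<delta>_def)
  have dist_foldr: "dist (foldr B w y) (foldr B w z) = dist y z" if "set w \<subseteq> J" for w y z
    by (rule dist_foldr_isometries[OF iso that])
  have transitive: "\<exists>w. set w \<subseteq> J \<and> dist (foldr B w y) z < 3 * \<eta>" if "y \<in> K" "z \<in> K" "\<eta> > 0" for y z \<eta>
  proof -
    obtain a where a: "set a \<subseteq> J" "dist (foldr B a x) y < \<eta>" using dense \<open>y \<in> K\<close> \<open>\<eta> > 0\<close> by blast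
    obtain b where b: "set b \<subseteq> J" "dist (foldr B b x) z < \<eta>" using dense \<open>z \<in> K\<close> \<open>\<eta> > 0\<close> by blast
    have "foldr B a ` K \<subseteq> K" using foldr_in_invariant[OF inv a(1)] by auto
    then obtain n where n: "n > 0" "dist ((foldr B a ^^ n) x) x < \<eta>"
      using isometry_recurrent[of "foldr B a", OF dist_foldr[OF a(1)] K _ x \<open>\<eta> > 0\<close>] by auto
    obtain m where m: "n = Suc m" using n by (cases n) auto
    \<comment> \<open>the approximate inverse of \<open>a\<close>\<close>
    define c where "c = concat (replicate m a)"
    have c: "set c \<subseteq> J" using a by (auto simp: c_def)
    have "foldr B c u = (foldr B a ^^ m) u" for u
      unfolding c_def by (induction m) auto
    then have "(foldr B a ^^ n) x = foldr B c (foldr B a x)"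
      by (simp add: m funpow_swap1)
    then have "dist (foldr B (b @ c) y) (foldr B b x) < 2 * \<eta>"
      using n(2) a dist_foldr[OF b(1)] dist_foldr[OF c, of "foldr B a x" y]
        dist_triangle[of "foldr B c y" x "foldr B c (foldr B a x)"]
      by (simp add: dist_commute)
    then have "dist (foldr B (b @ c) y) z < 3 * \<eta>"
      using b dist_triangle[of "foldr B (b @ c) y" z "foldr B b x"] by linarith
    moreover have "set (b @ c) \<subseteq> J" using b c by auto
    ultimately show ?thesis by blast
  qed
  obtain E where E: "finite E" "E \<subseteq> K" "K \<subseteq> (\<Union>y\<in>E. ball y \<delta>)"
    using seq_compact_imp_totally_bounded[of K] K \<delta>(1) unfolding compact_eq_seq_compact_metric by blast
  have "\<exists>w. \<forall>y\<in>E. \<forall>z\<in>E. set (w y z) \<subseteq> J \<and> dist (foldr B (w y z) y) z < 2 * \<delta>"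
  proof -
    have "\<forall>y\<in>E. \<forall>z\<in>E. \<exists>w. set w \<subseteq> J \<and> dist (foldr B w y) z < 2 * \<delta>"
      using transitive[of _ _ "2 * \<delta> / 3"] E(2) \<delta> by auto
    then show ?thesis by metis
  qed
  then obtain w where w: "\<And>y z. y \<in> E \<Longrightarrow> z \<in> E \<Longrightarrow> set (w y z) \<subseteq> J"
      "\<And>y z. y \<in> E \<Longrightarrow> z \<in> E \<Longrightarrow> dist (foldr B (w y z) y) z < 2 * \<delta>" by blast
  define M where "M = Max ((\<lambda>(y, z). length (w y z)) ` (E \<times> E))"
  show ?thesis
  proof (intro exI[of _ M] ballI)
    fix y z assume "y \<in> K" "z \<in> K"
    have near: "\<exists>y'\<in>E. dist y' y < \<delta>" if "y \<in> K" for y using E(3) that by (auto simp: ball_def)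
    obtain y' z' where y': "y' \<in> E" "dist y' y < \<delta>" and z': "z' \<in> E" "dist z' z < \<delta>"
      using near[OF \<open>y \<in> K\<close>] near[OF \<open>z \<in> K\<close>] by blast
    have "length (w y' z') \<le> M"
      unfolding M_def using E(1) y' z' by (intro Max_ge) auto
    moreover have "dist (foldr B (w y' z') y) z < e"
      using w(2)[OF y'(1) z'(1)] dist_foldr[OF w(1)[OF y'(1) z'(1)], of y y'] y' z' \<delta>
        dist_triangle[of "foldr B (w y' z') y" z' "foldr B (w y' z') y'"]
        dist_triangle[of "foldr B (w y' z') y" z z']
      by (simp add: dist_commute)
    ultimately show "\<exists>w. set w \<subseteq> J \<and> length w \<le> M \<and> dist (foldr B w y) z < e"
      using w(1)[OF y'(1) z'(1)] by blast
  qed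
qed

section \<open>A ball covered by its own images\<close>

text \<open>
  Here \<open>\<epsilon>\<close> is the angular precision, \<open>M \<epsilon>\<close> the word length that it costs, and the radius will be
  \<open>R = \<beta> \<bar>p\<bar> / (1 - s c)\<close>, so that \<open>(1 - s c) / \<beta>\<close> is \<open>\<bar>p\<bar> / R\<close>. The first inequality says that a
  ball of radius \<open>s c R\<close> about \<open>p\<close> reaches out far enough to make up for the contraction of
  \<open>M \<epsilon>\<close> steps, the second that it reaches inwards to the ball of radius \<open>s R\<close>.

  If \<open>c < 1\<close>, both inequalities hold strictly in the limit \<open>s = 1\<close>, for
  \<open>\<beta> = 1 - c / 2\<close> and \<open>\<epsilon> = c / 4\<close>, whatever \<open>M\<close> is. If \<open>c = 1\<close>, the first one becomes an equality in the
  limit and has to be decided at first order in \<open>d = 1 - s\<close>: the left side grows like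
  \<open>1 + M d\<close>, and a small \<open>\<beta>\<close> gives the right side the larger slope \<open>M + 1\<close>.
\<close>

lemma covering_parameters:
  fixes c :: real and M :: "real \<Rightarrow> nat"
  assumes c: "0 < c" "c \<le> 1"
  shows "\<exists>\<epsilon> \<beta>. 0 < \<epsilon> \<and> 0 < \<beta> \<and>
    (\<forall>\<^sub>F s in at_left 1. (1 / s) ^ M \<epsilon> \<le> s * c + (1 - \<epsilon>) * ((1 - s * c) / \<beta>) \<and>
       (1 + \<epsilon>) * ((1 - s * c) / \<beta>) < s * c + s)"
proof (cases "c = 1")
  case False
  with c have c1: "c < 1" by simp
  define \<epsilon> \<beta> where "\<epsilon> = c / 4" and "\<beta> = 1 - c / 2"
  have \<epsilon>\<beta>: "0 < \<epsilon>" "0 < \<beta>" using c by (auto simp: \<epsilon>_def \<beta>_def)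
  have 1: "1 < 1 * c + (1 - \<epsilon>) * ((1 - 1 * c) / \<beta>)"
  proof -
    have "(1 - c) * \<beta> < (1 - \<epsilon>) * (1 - c)"
      using c1 c by (auto simp: \<epsilon>_def \<beta>_def mult.commute[of "1 - c"] intro!: mult_strict_right_mono)
    then show ?thesis using \<epsilon>\<beta> by (simp add: field_simps)
  qed
  have 2: "(1 + \<epsilon>) * ((1 - 1 * c) / \<beta>) < 1 * c + 1"
  proof -
    have "(1 + c) * (1 - c / 2) - (1 + c / 4) * (1 - c) = c / 4 * (5 - c)"
      by (simp add: field_simps)
    moreover have "c / 4 * (5 - c) > 0" using c by simp
    ultimately have "(1 + \<epsilon>) * (1 - c) < (1 + c) * \<beta>"
      unfolding \<epsilon>_def \<beta>_def by linarith
    then show ?thesis using \<epsilon>\<beta> by (simp add: field_simps)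
  qed
  have "((\<lambda>s. s * c + (1 - \<epsilon>) * ((1 - s * c) / \<beta>) - (1 / s) ^ M \<epsilon>) \<longlongrightarrow>
      1 * c + (1 - \<epsilon>) * ((1 - 1 * c) / \<beta>) - (1 / 1) ^ M \<epsilon>) (at_left 1)"
    by (intro tendsto_intros) (use \<epsilon>\<beta> in auto)
  then have "\<forall>\<^sub>F s in at_left 1. 0 < s * c + (1 - \<epsilon>) * ((1 - s * c) / \<beta>) - (1 / s) ^ M \<epsilon>"
    by (rule order_tendstoD) (use 1 in simp)
  moreover have "((\<lambda>s. s * c + s - (1 + \<epsilon>) * ((1 - s * c) / \<beta>)) \<longlongrightarrow>
      1 * c + 1 - (1 + \<epsilon>) * ((1 - 1 * c) / \<beta>)) (at_left 1)"
    by (intro tendsto_intros) (use \<epsilon>\<beta> in auto)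
  then have "\<forall>\<^sub>F s in at_left 1. 0 < s * c + s - (1 + \<epsilon>) * ((1 - s * c) / \<beta>)"
    by (rule order_tendstoD) (use 2 in simp)
  ultimately have "\<forall>\<^sub>F s in at_left 1. (1 / s) ^ M \<epsilon> \<le> s * c + (1 - \<epsilon>) * ((1 - s * c) / \<beta>) \<and>
       (1 + \<epsilon>) * ((1 - s * c) / \<beta>) < s * c + s"
    by eventually_elim linarith
  with \<epsilon>\<beta> show ?thesis by blast
next
  case True
  define m where "m = M (1 / 2)"
  define \<beta> :: real where "\<beta> = 1 / (2 * (m + 2))"
  have "((\<lambda>s. s + s - (1 + 1 / 2) * (1 - s) * (2 * (real m + 2))) \<longlongrightarrow>
      1 + 1 - (1 + 1 / 2) * (1 - 1) * (2 * (real m + 2))) (at_left 1)"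
    by (intro tendsto_intros)
  then have "\<forall>\<^sub>F s in at_left 1. 0 < s + s - (1 + 1 / 2) * (1 - s) * (2 * (real m + 2))"
    by (rule order_tendstoD) simp
  moreover have "((\<lambda>s. real m * (m + 1) * (1 - s)) \<longlongrightarrow> real m * (m + 1) * (1 - 1)) (at_left 1)"
    by (intro tendsto_intros)
  then have "\<forall>\<^sub>F s in at_left 1. real m * (m + 1) * (1 - s) < 1"
    by (rule order_tendstoD) simp
  moreover have "\<forall>\<^sub>F s in at_left (1::real). s \<in> {0<..<1}"
    by (rule eventually_at_left_real) simp
  ultimately have "\<forall>\<^sub>F s in at_left 1. (1 / s) ^ M (1 / 2) \<le> s * c + (1 - 1 / 2) * ((1 - s * c) / \<beta>) \<and>
       (1 + 1 / 2) * ((1 - s * c) / \<beta>) < s * c + s"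
  proof eventually_elim
    case (elim s)
    define d where "d = 1 - s"
    have d: "0 < d" "d < 1" "s = 1 - d" "real m * (m + 1) * d < 1"
      using elim by (auto simp: d_def)
    \<comment> \<open>\<open>s ^ m (1 + (m + 1) d) \<ge> 1\<close>, by Bernoulli's inequality for \<open>s = 1 - d\<close>\<close>
    have "1 \<le> 1 + d * (1 - real m * (m + 1) * d)" using d by simp
    also have "\<dots> = (1 - m * d) * (1 + (m + 1) * d)" by (simp add: algebra_simps)
    also have "\<dots> \<le> s ^ m * (1 + (m + 1) * d)"
      using Bernoulli_inequality[of "- d" m] d by (intro mult_right_mono) auto
    finally have "(1 / s) ^ m \<le> 1 + (m + 1) * d"
      using elim by (simp add: field_simps power_divide)
    moreover have "(1 - s * c) / \<beta> = d * (2 * (real m + 2))"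
      by (simp add: True \<beta>_def d_def)
    moreover have "s * c + (1 - 1 / 2) * (d * (2 * (real m + 2))) = 1 + (m + 1) * d"
      by (simp add: True d_def algebra_simps)
    moreover have "(1 + 1 / 2) * (d * (2 * (real m + 2))) < s * c + s"
      using elim(1) by (simp add: True d_def algebra_simps)
    ultimately show ?case unfolding m_def[symmetric] by simp
  qed
  moreover have "0 < \<beta>" by (simp add: \<beta>_def)
  ultimately show ?thesis by (intro exI[of _ "1 / 2"] exI[of _ \<beta>]) simp
qed

lemma orthogonal_transformation_foldr:
  assumes "\<And>j. j \<in> J \<Longrightarrow> orthogonal_transformation (B j)" "set w \<subseteq> J"
  shows "orthogonal_transformation (foldr B w)"
  using assms(2)
proof (induction w)
  case Nil
  then show ?case using orthogonal_transformation_id by (simp add: id_def)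
next
  case (Cons j w)
  then show ?case using assms(1) orthogonal_transformation_compose[of "B j" "foldr B w"]
    by (simp add: o_def)
qed

lemma foldr_scaled_linear:
  fixes B :: "'i \<Rightarrow> 'a::real_vector \<Rightarrow> 'a"
  assumes "\<And>j. j \<in> J \<Longrightarrow> linear (B j)" "set w \<subseteq> J"
  shows "foldr (\<lambda>j x. s *\<^sub>R B j x) w x = s ^ length w *\<^sub>R foldr B w x"
  using assms(2) by (induction w) (auto simp: linear_cmul[OF assms(1)])

lemma image_ball_linear_similarity:
  fixes L :: "'a::euclidean_space \<Rightarrow> 'a"
  assumes L: "linear L" "\<And>x. norm (L x) = c * norm x" and c: "0 < c" and s: "0 < s"
    and v: "dist v (u - s *\<^sub>R L u) < s * c * R"
  shows "v \<in> (\<lambda>x. u + s *\<^sub>R L (x - u)) ` ball 0 R"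
proof -
  have "L x \<noteq> 0" if "x \<noteq> 0" for x
  proof -
    have "norm (L x) > 0" using that c by (simp add: L(2))
    then show ?thesis by simp
  qed
  then have "inj L" using linear_injective_0[OF L(1)] by blast
  then have "surj L" using L(1) linear_inj_imp_surj by blast
  then obtain x where x: "L x = (1 / s) *\<^sub>R (v - (u - s *\<^sub>R L u))" by (metis surjD)
  have sL: "s *\<^sub>R L x = v - (u - s *\<^sub>R L u)" using s unfolding x by simp
  have "s * c * norm x = norm (s *\<^sub>R L x)" using s by (simp add: L(2))
  also have "\<dots> < s * c * R" using v unfolding sL by (simp only: dist_norm)
  finally have "x \<in> ball 0 R" using c s by simp
  moreover have "v = u + s *\<^sub>R L (x - u)"
    unfolding linear_diff[OF L(1)] scaleR_diff_right sL by simp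
  ultimately show ?thesis by blast
qed

text \<open>
  Undoing a word of length \<open>k\<close> moves a point \<open>v\<close> of the shell to norm
  \<open>a = s ^ (- k) \<bar>v\<bar>\<close> and, for the right word, to a direction within \<open>\<epsilon>\<close> of that of \<open>p\<close>. It is then
  at distance at most \<open>\<bar>a - \<bar>p\<bar>\<bar> + \<epsilon> \<bar>p\<bar>\<close> from \<open>p\<close>, which the choice of parameters keeps below
  the radius \<open>s c R\<close> of the image ball about \<open>p\<close>. The radius \<open>R\<close> depends on \<open>s\<close> and may be
  unbounded as \<open>s\<close> tends to \<open>1\<close>.
\<close>

lemma ball_covered_by_images:
  fixes B :: "'i \<Rightarrow> 'a::euclidean_space \<Rightarrow> 'a" and L :: "'a \<Rightarrow> 'a"
  assumes B: "\<And>j. j \<in> J \<Longrightarrow> orthogonal_transformation (B j)" and J: "J \<noteq> {}"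
    and x: "norm x = 1"
    and dense: "\<And>y e. norm y = 1 \<Longrightarrow> 0 < e \<Longrightarrow> \<exists>w. set w \<subseteq> J \<and> dist (foldr B w x) y < e"
    and L: "linear L" "\<And>x. norm (L x) = c * norm x" and c: "0 < c" "c \<le> 1"
    and u: "u \<noteq> 0"
  shows "\<forall>\<^sub>F s in at_left 1. \<exists>R>0. \<forall>v\<in>ball 0 R.
     (\<exists>j\<in>J. v \<in> (\<lambda>x. s *\<^sub>R B j x) ` ball 0 R) \<or>
     (\<exists>w. set w \<subseteq> J \<and> v \<in> foldr (\<lambda>j x. s *\<^sub>R B j x) w ` (\<lambda>x. u + s *\<^sub>R L (x - u)) ` ball 0 R)"
proof -
  have linB: "linear (B j)" if "j \<in> J" for j using B[OF that] by (simp add: orthogonal_transformation)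
  have "\<exists>M. \<forall>y\<in>sphere 0 1. \<forall>z\<in>sphere 0 1. \<exists>w. set w \<subseteq> J \<and> length w \<le> M \<and> dist (foldr B w y) z < e"
    if "0 < e" for e
  proof (rule dense_orbit_uniformly_transitive[OF _ _ _ _ _ that])
    show "dist (B j y) (B j z) = dist y z" if "j \<in> J" for j y z
      using B[OF that] by (simp add: orthogonal_transformation_isometry)
    show "B j ` sphere 0 1 \<subseteq> sphere 0 1" if "j \<in> J" for j
      using B[OF that] by (auto simp: orthogonal_transformation)
  qed (use x dense in auto)
  then obtain M where M: "\<And>e y z. 0 < e \<Longrightarrow> norm y = 1 \<Longrightarrow> norm z = 1 \<Longrightarrow>
      \<exists>w. set w \<subseteq> J \<and> length w \<le> M e \<and> dist (foldr B w y) z < e"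
    by (metis mem_sphere_0)
  obtain \<epsilon> \<beta> where \<epsilon>\<beta>: "0 < \<epsilon>" "0 < \<beta>" and ev:
    "\<forall>\<^sub>F s in at_left 1. (1 / s) ^ M \<epsilon> \<le> s * c + (1 - \<epsilon>) * ((1 - s * c) / \<beta>) \<and>
       (1 + \<epsilon>) * ((1 - s * c) / \<beta>) < s * c + s"
    using covering_parameters[OF c, of M] by blast
  have "\<forall>\<^sub>F s in at_left (1::real). s \<in> {0<..<1}"
    by (rule eventually_at_left_real) simp
  with ev show ?thesis
  proof eventually_elim
    case (elim s)
    then have s: "0 < s" "s < 1" by auto
    define l where "l = s * c"
    have "l \<le> s * 1" unfolding l_def using s c by (intro mult_left_mono) auto
    moreover have "0 < l" using s c by (simp add: l_def)
    ultimately have l: "0 < l" "l < 1" using s by auto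
    define p where "p = u - s *\<^sub>R L u"
    have "norm u - l * norm u \<le> norm p"
      using norm_triangle_ineq2[of u "s *\<^sub>R L u"] s by (simp add: p_def L(2) l_def)
    moreover have "norm u - l * norm u > 0" using l u by simp
    ultimately have p: "norm p > 0" by linarith
    define R where "R = \<beta> * norm p / (1 - l)"
    have R: "R > 0" using p l \<epsilon>\<beta> by (simp add: R_def)
    have pR: "norm p = (1 - l) / \<beta> * R" using l \<epsilon>\<beta> by (simp add: R_def)
    have outer: "(1 / s) ^ M \<epsilon> * R \<le> l * R + (1 - \<epsilon>) * norm p"
    proof -
      have "(1 / s) ^ M \<epsilon> * R \<le> (l + (1 - \<epsilon>) * ((1 - l) / \<beta>)) * R"
        using elim R by (intro mult_right_mono) (auto simp: l_def)
      then show ?thesis by (simp add: pR algebra_simps)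
    qed
    have inner: "(1 + \<epsilon>) * norm p < l * R + s * R"
    proof -
      have "((1 + \<epsilon>) * ((1 - l) / \<beta>)) * R < (l + s) * R"
        using elim R by (intro mult_strict_right_mono) (auto simp: l_def)
      then show ?thesis by (simp add: pR algebra_simps)
    qed
    show ?case
    proof (intro exI[of _ R] conjI ballI R)
      fix v :: 'a assume "v \<in> ball 0 R"
      then have vR: "norm v < R" by simp
      show "(\<exists>j\<in>J. v \<in> (\<lambda>x. s *\<^sub>R B j x) ` ball 0 R) \<or>
        (\<exists>w. set w \<subseteq> J \<and> v \<in> foldr (\<lambda>j x. s *\<^sub>R B j x) w ` (\<lambda>x. u + s *\<^sub>R L (x - u)) ` ball 0 R)"
      proof (cases "norm v < s * R")
        case True
        obtain j where j: "j \<in> J" using J by blast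
        obtain y where y: "B j y = (1 / s) *\<^sub>R v"
          using orthogonal_transformation_surj[OF B[OF j]] by (metis surjD)
        have "norm y = norm (B j y)" using B[OF j] by (simp add: orthogonal_transformation)
        also have "\<dots> < R" using True s by (simp add: y field_simps)
        finally have "y \<in> ball 0 R" by simp
        moreover have "v = s *\<^sub>R B j y" using s by (simp add: y)
        ultimately show ?thesis using j by blast
      next
        case False
        then have v: "s * R \<le> norm v" "norm v > 0"
          using mult_pos_pos[OF s(1) R] by linarith+
        obtain w where w: "set w \<subseteq> J" "length w \<le> M \<epsilon>" "dist (foldr B w (p /\<^sub>R norm p)) (v /\<^sub>R norm v) < \<epsilon>"
          using M[of \<epsilon> "p /\<^sub>R norm p" "v /\<^sub>R norm v"] \<epsilon>\<beta> p v by auto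
        let ?k = "length w"
        have Bw: "orthogonal_transformation (foldr B w)"
          by (rule orthogonal_transformation_foldr[OF B w(1)])
        then have lin: "linear (foldr B w)" and nrm: "\<And>y. norm (foldr B w y) = norm y"
          by (auto simp: orthogonal_transformation)
        obtain z where z: "foldr B w z = (1 / s) ^ ?k *\<^sub>R v"
          using orthogonal_transformation_surj[OF Bw] by (metis surjD)
        define a where "a = (1 / s) ^ ?k * norm v"
        have a: "s * R \<le> a" "a < (1 / s) ^ M \<epsilon> * R"
        proof -
          have "1 \<le> (1 / s) ^ ?k" using s by (intro one_le_power) simp
          then have "1 * norm v \<le> a" unfolding a_def by (intro mult_right_mono) auto
          with v show "s * R \<le> a" by simp
          have "(1 / s) ^ ?k \<le> (1 / s) ^ M \<epsilon>" using s w by (intro power_increasing) auto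
          then have "a \<le> (1 / s) ^ M \<epsilon> * norm v" unfolding a_def by (intro mult_right_mono) auto
          also have "\<dots> < (1 / s) ^ M \<epsilon> * R" using vR s by simp
          finally show "a < (1 / s) ^ M \<epsilon> * R" .
        qed
        let ?e = "foldr B w (p /\<^sub>R norm p)" and ?v = "v /\<^sub>R norm v"
        have "foldr B w p = norm p *\<^sub>R ?e"
          using p by (simp add: linear_cmul[OF lin])
        moreover have "foldr B w z = a *\<^sub>R ?v" using v by (simp add: z a_def)
        ultimately have "foldr B w (z - p) = (a - norm p) *\<^sub>R ?v + norm p *\<^sub>R (?v - ?e)"
          by (simp add: linear_diff[OF lin] algebra_simps)
        then have "norm (z - p) = norm ((a - norm p) *\<^sub>R ?v + norm p *\<^sub>R (?v - ?e))"
          by (metis nrm)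
        also have "\<dots> \<le> norm ((a - norm p) *\<^sub>R ?v) + norm (norm p *\<^sub>R (?v - ?e))"
          by (rule norm_triangle_ineq)
        also have "\<dots> = \<bar>a - norm p\<bar> * norm ?v + norm p * norm (?v - ?e)"
          by (simp only: norm_scaleR abs_norm_cancel)
        also have "\<dots> \<le> \<bar>a - norm p\<bar> + norm p * \<epsilon>"
        proof -
          have "norm ?v = 1" using v by simp
          moreover have "norm p * norm (?v - ?e) \<le> norm p * \<epsilon>"
            using w(3) by (intro mult_left_mono) (auto simp: dist_norm norm_minus_commute)
          ultimately show ?thesis by simp
        qed
        also have "\<dots> < l * R"
        proof -
          have "l * R + (1 - \<epsilon>) * norm p = l * R + norm p - norm p * \<epsilon>"
            by (simp add: algebra_simps)
          then have "a < l * R + norm p - norm p * \<epsilon>"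
            using less_le_trans[OF a(2) outer] by simp
          moreover have "norm p + norm p * \<epsilon> < l * R + s * R"
            using inner by (simp add: algebra_simps)
          ultimately show ?thesis using a(1) by linarith
        qed
        finally have "z \<in> (\<lambda>x. u + s *\<^sub>R L (x - u)) ` ball 0 R"
          using image_ball_linear_similarity[OF L c(1) s(1), of z u R] by (simp add: dist_norm p_def l_def)
        moreover have "v = foldr (\<lambda>j x. s *\<^sub>R B j x) w z"
          using s foldr_scaled_linear[OF linB w(1), where s = s and x = z] by (simp add: z power_one_over)
        ultimately show ?thesis using w(1) by blast
      qed
    qed
  qed
qed

section \<open>Similarity families\<close>

lemma similarity_ratio_unique:
  fixes f :: "real ^ 'n \<Rightarrow> real ^ 'n"
  assumes "similarity_with_ratio r f" "similarity_with_ratio r' f"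
  shows "r = r'"
proof -
  have "r * dist (axis undefined 1) (0 :: real ^ 'n) = r' * dist (axis undefined 1) (0 :: real ^ 'n)"
    using assms by (metis similarity_with_ratio_def)
  then show ?thesis by simp
qed

lemma scaling_ratio_eq: "similarity_with_ratio r f \<Longrightarrow> scaling_ratio f = r"
  unfolding scaling_ratio_def by (rule the_equality) (auto dest: similarity_ratio_unique)

lemma linear_part_eq:
  fixes f :: "real ^ 'n \<Rightarrow> real ^ 'n"
  assumes "\<And>x. f x = L *v x + a"
  shows "linear_part f = L"
  unfolding linear_part_def
proof (rule the_equality)
  fix M assume "\<exists>b. \<forall>x. f x = M *v x + b"
  then obtain b where b: "\<And>x. M *v x + b = L *v x + a" using assms by metis
  from b[of 0] have "b = a" by simp
  with b show "M = L" by (simp add: matrix_eq)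
qed (use assms in blast)

lemma similarity_family_form:
  fixes f :: "nat \<Rightarrow> real ^ 'n \<Rightarrow> real ^ 'n"
  assumes "similarity_family N f" "i \<in> {1..N}"
  shows "f i x = linear_part (f i) *v x + f i 0"
    and "norm (linear_part (f i) *v x) = scaling_ratio (f i) * norm x"
    and "0 < scaling_ratio (f i)"
proof -
  obtain L a r where L: "\<And>x. f i x = L *v x + a" and r: "similarity_with_ratio r (f i)"
    using assms unfolding similarity_family_def affine_family_def affine_function_def by metis
  have lp: "linear_part (f i) = L" by (rule linear_part_eq[OF L])
  have sr: "scaling_ratio (f i) = r" by (rule scaling_ratio_eq[OF r])
  show "f i x = linear_part (f i) *v x + f i 0" by (simp add: lp L)
  show "0 < scaling_ratio (f i)" using r by (simp add: sr similarity_with_ratio_def)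
  have "dist (f i x) (f i 0) = r * dist x 0" using r by (simp add: similarity_with_ratio_def)
  then show "norm (linear_part (f i) *v x) = scaling_ratio (f i) * norm x"
    by (simp add: lp sr L dist_norm)
qed

lemma onorm_matrix_scaled_isometry:
  fixes M :: "real ^ 'n ^ 'n"
  assumes "\<And>x. norm (M *v x) = c * norm x"
  shows "onorm ((*v) M) = c"
proof (rule antisym)
  show "onorm ((*v) M) \<le> c" by (rule onorm_le) (simp add: assms)
  have "norm (M *v axis undefined 1) \<le> onorm ((*v) M) * norm (axis undefined 1 :: real ^ 'n)"
    by (rule onorm) (rule matrix_vector_mul_bounded_linear)
  then show "c \<le> onorm ((*v) M)" by (simp add: assms)
qed

text \<open>
  A product of similarities has the product of the ratios as its norm, so the maximum over words of
  length \<open>k\<close> is exactly \<open>\<rho> ^ k\<close>, attained by repeating one letter.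
\<close>

lemma joint_spectral_radius_similarity:
  fixes f :: "nat \<Rightarrow> real ^ 'n \<Rightarrow> real ^ 'n"
  assumes sim: "similarity_family N f"
  shows "joint_spectral_radius N f = Max ((\<lambda>i. scaling_ratio (f i)) ` {1..N})" (is "_ = ?\<rho>")
proof -
  let ?r = "\<lambda>i. scaling_ratio (f i)"
  have N: "{1..N} \<noteq> {}" using sim by (auto simp: similarity_family_def affine_family_def)
  have r_le: "?r i \<le> ?\<rho>" if "i \<in> {1..N}" for i using that by (intro Max_ge) auto
  have "?\<rho> \<in> ?r ` {1..N}" using N by (intro Max_in) auto
  then obtain m where m: "m \<in> {1..N}" "?r m = ?\<rho>" by auto
  have \<rho>: "0 < ?\<rho>" using similarity_family_form(3)[OF sim m(1)] m(2) by simp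
  have onorm: "onorm ((*v) (word_product f w)) = prod_list (map ?r w)" if "set w \<subseteq> {1..N}" for w
  proof (rule onorm_matrix_scaled_isometry)
    show "norm (word_product f w *v x) = prod_list (map ?r w) * norm x" for x
      using that
    proof (induction w)
      case (Cons i w)
      then show ?case using similarity_family_form(2)[OF sim, of i]
        by (simp add: word_product_def matrix_vector_mul_assoc[symmetric])
    qed (simp add: word_product_def)
  qed
  have prod_le: "prod_list (map ?r w) \<le> ?\<rho> ^ length w \<and> 0 \<le> prod_list (map ?r w)" if "set w \<subseteq> {1..N}" for w
    using that
  proof (induction w)
    case (Cons i w)
    then have "?r i \<le> ?\<rho>" "0 < ?r i" "prod_list (map ?r w) \<le> ?\<rho> ^ length w" "0 \<le> prod_list (map ?r w)"
      using r_le[of i] similarity_family_form(3)[OF sim, of i] by auto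
    then show ?case
      using mult_mono[of "?r i" ?\<rho> "prod_list (map ?r w)" "?\<rho> ^ length w"] \<rho>
      by (simp only: list.map list.size prod_list.Cons power_Suc add_Suc_right add_0_right)
        (simp add: mult_nonneg_nonneg less_imp_le)
  qed simp
  have "Max ((\<lambda>w. onorm ((*v) (word_product f w))) ` {w. length w = k \<and> set w \<subseteq> {1..N}}) = ?\<rho> ^ k" for k
  proof (rule Max_eqI)
    have "finite {w :: nat list. set w \<subseteq> {1..N} \<and> length w = k}" by (rule finite_lists_length_eq) simp
    then show "finite ((\<lambda>w. onorm ((*v) (word_product f w))) ` {w. length w = k \<and> set w \<subseteq> {1..N}})"
      by (simp add: conj_commute)
    show "y \<le> ?\<rho> ^ k" if "y \<in> (\<lambda>w. onorm ((*v) (word_product f w))) ` {w. length w = k \<and> set w \<subseteq> {1..N}}" for y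
      using that onorm prod_le by auto
    have "onorm ((*v) (word_product f (replicate k m))) = ?\<rho> ^ k"
      using onorm[of "replicate k m"] m(1) unfolding m(2)[symmetric]
      by (cases "k = 0") (auto simp: set_replicate_conv_if)
    then show "?\<rho> ^ k \<in> (\<lambda>w. onorm ((*v) (word_product f w))) ` {w. length w = k \<and> set w \<subseteq> {1..N}}"
      using m by (intro image_eqI[of _ _ "replicate k m"]) auto
  qed
  then have "joint_spectral_radius N f = real_of_ereal (limsup (\<lambda>k. ereal (root k (?\<rho> ^ k))))"
    by (simp add: joint_spectral_radius_def)
  also have "limsup (\<lambda>k. ereal (root k (?\<rho> ^ k))) = ereal ?\<rho>"
  proof (rule lim_imp_Limsup)
    have "\<forall>\<^sub>F k in sequentially. ereal (root k (?\<rho> ^ k)) = ereal ?\<rho>"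
      using eventually_gt_at_top[of 0] by eventually_elim (use \<rho> in \<open>simp add: real_root_power_cancel\<close>)
    then show "(\<lambda>k. ereal (root k (?\<rho> ^ k))) \<longlonglongrightarrow> ereal ?\<rho>" by (rule tendsto_eventually)
  qed simp
  finally show ?thesis by simp
qed

text \<open>
  A linear map fixes \<open>0\<close>, so every map of the family with index \<open>i\<close> fixes \<open>h 0\<close>. The constant map at
  \<open>t = 0\<close> identifies this point as \<open>q i\<close>, and a positive parameter gives the equation.
\<close>

lemma semi_linear_vanishes_at_translation:
  assumes semi: "semi_linear_family N f q" and pos: "0 < critical_parameter N f" and i: "i \<in> {1..N}"
  shows "f i (q i) = 0"
proof -
  let ?t = "critical_parameter N f / 2"
  obtain h where h: "\<And>t. t \<in> {0..<critical_parameter N f} \<Longrightarrow>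
      \<exists>g. linear g \<and> conjugate_by h (family_map f q t i) g"
    using semi i unfolding semi_linear_family_def by blast
  have fixed: "bij h \<and> family_map f q t i (h 0) = h 0" if t: "t \<in> {0..<critical_parameter N f}" for t
  proof -
    obtain g where g: "linear g" "bij h" "g = inv h \<circ> family_map f q t i \<circ> h"
      using h[OF t] by (auto simp: conjugate_by_def)
    have "inv h (family_map f q t i (h 0)) = 0" using linear_0[OF g(1)] g(3) by simp
    then show ?thesis using g(2) by (metis bij_inv_eq_iff)
  qed
  have "h 0 = q i" using fixed[of 0] pos by (simp add: family_map_def)
  then show ?thesis using fixed[of ?t] pos by (simp add: family_map_def)
qed

lemma concentric_family_linear:
  fixes f :: "nat \<Rightarrow> real ^ 'n \<Rightarrow> real ^ 'n"
  assumes sim: "similarity_family N f" and "\<And>i. i \<in> {1..N} \<Longrightarrow> q i = c" "\<And>i. i \<in> {1..N} \<Longrightarrow> f i (q i) = 0"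
  shows "linear_family N f q"
  unfolding linear_family_def
proof (rule exI[of _ "\<lambda>v. v + c"], intro ballI)
  fix i t assume i: "i \<in> {1..N}" and "t \<in> {0..<critical_parameter N f}"
  let ?L = "linear_part (f i)"
  have f: "f i (v + c) = ?L *v v" for v
    using similarity_family_form(1)[OF sim i, of c] similarity_family_form(1)[OF sim i, of "v + c"] assms(2,3)[OF i]
    by (simp add: matrix_vector_right_distrib)
  have b: "bij (\<lambda>v. v + c)" by (rule bij_plus_right)
  have inv: "inv (\<lambda>v. v + c) y = y - c" for y
    by (rule inv_f_eq) (auto simp: inj_def)
  show "\<exists>g. linear g \<and> conjugate_by (\<lambda>v. v + c) (family_map f q t i) g"
    by (rule exI[of _ "\<lambda>v. t *\<^sub>R (?L *v v)"])
      (auto simp: conjugate_by_def b inv f family_map_def assms(2)[OF i] fun_eq_iff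
        intro!: linear_compose_scale_right)
qed

lemma orbit_under_foldr:
  assumes "y \<in> orbit_under (\<phi> ` J) x"
  shows "\<exists>w. set w \<subseteq> J \<and> y = foldr \<phi> w x"
  using assms
proof induction
  case base
  show ?case by (rule exI[of _ "[]"]) simp
next
  case (step y g)
  then obtain j w where "j \<in> J" "g = \<phi> j" "set w \<subseteq> J" "y = foldr \<phi> w x" by blast
  then show ?case by (intro exI[of _ "j # w"]) auto
qed

lemma foldr_translate:
  assumes "\<And>j v. j \<in> J \<Longrightarrow> \<phi> j (c + v) = c + \<psi> j v" "set w \<subseteq> J"
  shows "foldr \<phi> w (c + v) = c + foldr \<psi> w (v :: 'a :: group_add)"
  using assms(2) by (induction w) (auto simp: assms(1))

theorem theorem7p4:
  fixes N :: nat
    and f :: "nat \<Rightarrow> real ^ 'n \<Rightarrow> real ^ 'n"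
    and q :: "nat \<Rightarrow> real ^ 'n"
    and t\<^sub>0 \<rho> :: real
    and J :: "nat set"
    and q\<^sub>0 x :: "real ^ 'n"
  assumes "similarity_family N f"
    and "t\<^sub>0 = critical_parameter N f"
    and "semi_linear_family N f q"
    and "\<not> linear_family N f q"
    and "\<rho> = Max ((\<lambda>i. scaling_ratio (f i)) ` {1..N})"
    and "J \<subseteq> {i \<in> {1..N}. scaling_ratio (f i) = \<rho>}"
    and "\<forall>i\<in>J. q i = q\<^sub>0"
    and "x \<in> sphere q\<^sub>0 1"
    and "sphere q\<^sub>0 1 \<subseteq> closure (orbit_under (family_map f q t\<^sub>0 ` J) x)"
  shows "\<exists>\<tau>. 0 \<le> \<tau> \<and> \<tau> < t\<^sub>0 \<and>
    (\<forall>t\<in>{\<tau><..<t\<^sub>0}. \<exists>A. is_attractor (family_at N f q t) A \<and> interior A \<noteq> {})"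
proof -
  note sim = assms(1) and form = similarity_family_form[OF assms(1)]
  let ?r = "\<lambda>i. scaling_ratio (f i)" and ?L = "\<lambda>i. linear_part (f i)"
  have N: "{1..N} \<noteq> {}" using sim by (auto simp: similarity_family_def affine_family_def)
  have r_le: "?r i \<le> \<rho>" if "i \<in> {1..N}" for i
    unfolding assms(5) using that by (intro Max_ge) auto
  have \<rho>: "0 < \<rho>" using N form(3) r_le by (meson ex_in_conv order_less_le_trans)
  have t0: "t\<^sub>0 = 1 / \<rho>"
    by (simp add: assms(2,5) critical_parameter_def joint_spectral_radius_similarity[OF sim])
  have t0_pos: "0 < t\<^sub>0" using \<rho> by (simp add: t0)
  have fq: "f i (q i) = 0" if "i \<in> {1..N}" for i
    using semi_linear_vanishes_at_translation[OF assms(3) _ that] t0_pos assms(2) by simp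
  have f: "f i v = ?L i *v (v - q i)" if "i \<in> {1..N}" for i v
    using form(1)[OF that, of "q i"] form(1)[OF that, of v] fq[OF that]
    by (simp add: matrix_vector_mult_diff_distrib algebra_simps)
  obtain i where i: "i \<in> {1..N}" "q i \<noteq> q\<^sub>0"
    using concentric_family_linear[OF sim _ fq] assms(4) by blast
  define u where "u = q i - q\<^sub>0"
  define B where "B j v = t\<^sub>0 *\<^sub>R (?L j *v v)" for j v
  define L where "L v = t\<^sub>0 *\<^sub>R (?L i *v v)" for v
  define c where "c = t\<^sub>0 * ?r i"
  have c: "0 < c" "c \<le> 1" using form(3)[OF i(1)] r_le[OF i(1)] \<rho> by (auto simp: c_def t0)
  have J: "j \<in> {1..N}" "?r j = \<rho>" "q j = q\<^sub>0" if "j \<in> J" for j using assms(6,7) that by auto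
  have B: "orthogonal_transformation (B j)" if "j \<in> J" for j
    unfolding orthogonal_transformation
  proof (intro conjI allI)
    show "linear (B j)" unfolding B_def by (intro linear_compose_scale_right) simp
    show "norm (B j v) = norm v" for v using form(2) J[OF that] \<rho> by (simp add: B_def t0)
  qed
  have lin_L: "linear L" unfolding L_def by (intro linear_compose_scale_right) simp
  have norm_L: "norm (L v) = c * norm v" for v
    using form(2)[OF i(1)] t0_pos by (simp add: L_def c_def)
  have B_map: "family_map f q t j (q\<^sub>0 + v) = q\<^sub>0 + (t / t\<^sub>0) *\<^sub>R B j v" if "j \<in> J" for t j v
    using J[OF that] t0_pos by (simp add: family_map_def f B_def)
  have L_map: "family_map f q t i (q\<^sub>0 + v) = q\<^sub>0 + (u + (t / t\<^sub>0) *\<^sub>R L (v - u))" for t v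
    using i(1) t0_pos by (simp add: family_map_def f L_def u_def algebra_simps)
  \<comment> \<open>an empty composition alone reaches one point, but the sphere has two\<close>
  have J_ne: "J \<noteq> {}"
  proof
    assume "J = {}"
    have "orbit_under ({} :: (real ^ 'n \<Rightarrow> real ^ 'n) set) x = {x}"
      by (auto elim: orbit_under.cases intro: orbit_under.base)
    then have "sphere q\<^sub>0 1 \<subseteq> {x}" using assms(9) \<open>J = {}\<close> by simp
    moreover have "q\<^sub>0 + axis undefined 1 \<in> sphere q\<^sub>0 1" "q\<^sub>0 - axis undefined 1 \<in> sphere q\<^sub>0 1"
      by (auto simp: dist_norm)
    ultimately have "q\<^sub>0 + axis undefined 1 = q\<^sub>0 - axis undefined 1" by blast
    moreover have "(2 :: real) *\<^sub>R axis undefined 1 = (q\<^sub>0 + axis undefined 1) - (q\<^sub>0 - axis undefined 1)"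
      by (simp add: scaleR_2)
    ultimately have "(2 :: real) *\<^sub>R axis undefined 1 = (0 :: real ^ 'n)" by simp
    then show False by (simp add: axis_eq_0_iff)
  qed
  have dense: "\<exists>w. set w \<subseteq> J \<and> dist (foldr B w (x - q\<^sub>0)) y < e" if "norm y = 1" "0 < e" for y e
  proof -
    have "q\<^sub>0 + y \<in> sphere q\<^sub>0 1" using that by (simp add: dist_norm)
    then have "q\<^sub>0 + y \<in> closure (orbit_under (family_map f q t\<^sub>0 ` J) x)" using assms(9) by blast
    then obtain z where z: "z \<in> orbit_under (family_map f q t\<^sub>0 ` J) x" "dist z (q\<^sub>0 + y) < e"
      using \<open>0 < e\<close> by (auto simp: closure_approachable)
    obtain w where w: "set w \<subseteq> J" "z = foldr (family_map f q t\<^sub>0) w x"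
      using orbit_under_foldr[OF z(1)] by blast
    have "z = q\<^sub>0 + foldr B w (x - q\<^sub>0)"
      using foldr_translate[of J "family_map f q t\<^sub>0" q\<^sub>0 B w "x - q\<^sub>0"] B_map[of _ t\<^sub>0] t0_pos w by simp
    then show ?thesis using z(2) w(1) by auto
  qed
  have "norm (x - q\<^sub>0) = 1" using assms(8) by (simp add: dist_norm norm_minus_commute)
  from ball_covered_by_images[OF B J_ne this dense lin_L norm_L c, of u] i(2)
  obtain \<sigma> where "\<sigma> < 1" and \<sigma>: "\<And>s. \<sigma> < s \<Longrightarrow> s < 1 \<Longrightarrow> \<exists>R>0. \<forall>v\<in>ball 0 R.
     (\<exists>j\<in>J. v \<in> (\<lambda>x. s *\<^sub>R B j x) ` ball 0 R) \<or>
     (\<exists>w. set w \<subseteq> J \<and> v \<in> foldr (\<lambda>j x. s *\<^sub>R B j x) w ` (\<lambda>x. u + s *\<^sub>R L (x - u)) ` ball 0 R)"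
    by (auto simp: eventually_at_left_field u_def)
  define \<tau> where "\<tau> = max 0 \<sigma> * t\<^sub>0"
  show ?thesis
  proof (intro exI[of _ \<tau>] conjI ballI)
    show "0 \<le> \<tau>" using t0_pos by (simp add: \<tau>_def)
    show "\<tau> < t\<^sub>0" using \<open>\<sigma> < 1\<close> t0_pos by (simp add: \<tau>_def)
  next
    fix t assume t: "t \<in> {\<tau><..<t\<^sub>0}"
    define s where "s = t / t\<^sub>0"
    let ?\<phi> = "family_map f q t" and ?\<Phi> = "family_at N f q t"
    have "max 0 \<sigma> < s"
      using t t0_pos by (simp only: s_def \<tau>_def greaterThanLessThan_iff pos_less_divide_eq)
    moreover have "s < 1" using t t0_pos by (simp add: s_def)
    ultimately have s: "\<sigma> < s" "0 < s" "s < 1" by auto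
    have t_pos: "0 < t" using s(2) t0_pos by (simp add: s_def zero_less_divide_iff)
    have contr: "dist (g y) (g z) \<le> s * dist y z" if "g \<in> ?\<Phi>" for g y z
    proof -
      obtain k where k: "k \<in> {1..N}" "g = ?\<phi> k"
        using \<open>g \<in> ?\<Phi>\<close> by (auto simp: family_at_def)
      have "dist (g y) (g z) = t * (?r k * dist y z)"
        using form(2)[OF k(1), of "y - z"] t_pos
        by (simp add: k family_map_def f[OF k(1)] dist_norm matrix_vector_mult_diff_distrib
          flip: scaleR_diff_right)
      also have "\<dots> \<le> t * (\<rho> * dist y z)"
        using r_le[OF k(1)] t_pos by (intro mult_left_mono mult_right_mono) auto
      finally show ?thesis by (simp add: s_def t0)
    qed
    obtain R where R: "R > 0" and cover: "\<And>v. v \<in> ball 0 R \<Longrightarrow>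
       (\<exists>j\<in>J. v \<in> (\<lambda>x. s *\<^sub>R B j x) ` ball 0 R) \<or>
       (\<exists>w. set w \<subseteq> J \<and> v \<in> foldr (\<lambda>j x. s *\<^sub>R B j x) w ` (\<lambda>x. u + s *\<^sub>R L (x - u)) ` ball 0 R)"
      using \<sigma>[OF s(1,3)] by blast
    have fold_B: "foldr ?\<phi> w (q\<^sub>0 + v) = q\<^sub>0 + foldr (\<lambda>j x. s *\<^sub>R B j x) w v" if "set w \<subseteq> J" for w v
      by (rule foldr_translate[OF _ that]) (simp add: B_map s_def)
    have self_cover: "\<exists>k w z. k \<in> {1..N} \<and> set w \<subseteq> {1..N} \<and> z \<in> ball q\<^sub>0 R \<and> y = foldr ?\<phi> (k # w) z"
      if y: "y \<in> ball q\<^sub>0 R" for y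
    proof -
      have "y - q\<^sub>0 \<in> ball 0 R" using y by (simp add: dist_norm norm_minus_commute)
      from cover[OF this] consider j v where "j \<in> J" "y - q\<^sub>0 = s *\<^sub>R B j v" "v \<in> ball 0 R"
        | w v where "set w \<subseteq> J" "y - q\<^sub>0 = foldr (\<lambda>j x. s *\<^sub>R B j x) w (u + s *\<^sub>R L (v - u))" "v \<in> ball 0 R"
        by blast
      then show ?thesis
      proof cases
        case 1
        then have "y = foldr ?\<phi> [j] (q\<^sub>0 + v)" by (simp add: B_map algebra_simps flip: s_def)
        moreover have "q\<^sub>0 + v \<in> ball q\<^sub>0 R" using 1 by (simp add: dist_norm)
        ultimately show ?thesis using J(1)[OF 1(1)] by (metis empty_subsetI list.set(1))
      next
        case 2
        then have "y = foldr ?\<phi> (w @ [i]) (q\<^sub>0 + v)"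
          by (simp add: L_map fold_B algebra_simps flip: s_def)
        moreover have "q\<^sub>0 + v \<in> ball q\<^sub>0 R" using 2 by (simp add: dist_norm)
        moreover have "set (w @ [i]) \<subseteq> {1..N}" using 2(1) i(1) J(1) by auto
        moreover obtain k w' where "w @ [i] = k # w'" by (cases w) auto
        ultimately show ?thesis by (metis insert_subset list.set(2))
      qed
    qed
    \<comment> \<open>the ball is covered by compositions of several maps; all its images together are covered by
        single maps\<close>
    define X where "X = (\<Union>w\<in>{w. set w \<subseteq> {1..N}}. foldr ?\<phi> w ` ball q\<^sub>0 R)"
    have X_step: "X \<subseteq> hutchinson ?\<Phi> X"
    proof
      fix y assume "y \<in> X"
      then obtain w z where w: "set w \<subseteq> {1..N}" "z \<in> ball q\<^sub>0 R" "y = foldr ?\<phi> w z" by (auto simp: X_def)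
      have "\<exists>k w z. k \<in> {1..N} \<and> set w \<subseteq> {1..N} \<and> z \<in> ball q\<^sub>0 R \<and> y = foldr ?\<phi> (k # w) z"
      proof (cases w)
        case Nil
        then show ?thesis using self_cover w by simp
      next
        case (Cons k w')
        then show ?thesis using w by (metis insert_subset list.set(2))
      qed
      then obtain k w z where "k \<in> {1..N}" "set w \<subseteq> {1..N}" "z \<in> ball q\<^sub>0 R" "y = ?\<phi> k (foldr ?\<phi> w z)"
        by auto
      then show "y \<in> hutchinson ?\<Phi> X"
        unfolding hutchinson_def family_at_def X_def by blast
    qed
    have ball_X: "ball q\<^sub>0 R \<subseteq> X"
      unfolding X_def by (rule order_trans[OF _ UN_upper[of "[]"]]) auto
    \<comment> \<open>a ball about the origin mapped into itself by the family, large enough to contain the ball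
        about \<open>q\<^sub>0\<close>\<close>
    define C where "C = Max ((\<lambda>k. norm (?\<phi> k 0)) ` {1..N})"
    define D where "D = max (C / (1 - s)) (norm q\<^sub>0 + R)"
    have inv: "?\<phi> k ` cball 0 D \<subseteq> cball 0 D" if k: "k \<in> {1..N}" for k
    proof safe
      fix y :: "real ^ 'n" assume y: "y \<in> cball 0 D"
      have "norm (?\<phi> k 0) \<le> C" unfolding C_def using k by (intro Max_ge) auto
      also have "\<dots> \<le> (1 - s) * D"
      proof -
        have "C / (1 - s) \<le> D" by (simp add: D_def)
        then show ?thesis using s by (simp add: pos_divide_le_eq mult.commute)
      qed
      finally have "norm (?\<phi> k 0) \<le> (1 - s) * D" .
      moreover have "norm (?\<phi> k y - ?\<phi> k 0) \<le> s * D"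
      proof -
        have "norm (?\<phi> k y - ?\<phi> k 0) \<le> s * norm y"
          using contr[of "?\<phi> k" y 0] k by (simp add: family_at_def dist_norm)
        also have "\<dots> \<le> s * D" using y s by (intro mult_left_mono) auto
        finally show ?thesis .
      qed
      ultimately have "norm (?\<phi> k y) \<le> D"
        using norm_triangle_sub[of "?\<phi> k y" "?\<phi> k 0"] by (simp add: algebra_simps)
      then show "?\<phi> k y \<in> cball 0 D" by simp
    qed
    have ball_D: "ball q\<^sub>0 R \<subseteq> cball 0 D"
    proof
      fix y assume "y \<in> ball q\<^sub>0 R"
      then show "y \<in> cball 0 D" using norm_triangle_sub[of y q\<^sub>0]
        by (simp add: D_def dist_norm norm_minus_commute)
    qed
    have X_sub: "X \<subseteq> cball 0 D"
    proof
      fix y assume "y \<in> X"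
      then obtain w z where w: "set w \<subseteq> {1..N}" "z \<in> ball q\<^sub>0 R" "y = foldr ?\<phi> w z"
        unfolding X_def by blast
      have "z \<in> cball 0 D" using w(2) ball_D by blast
      then show "y \<in> cball 0 D"
        using foldr_in_invariant[of "{1..N}" ?\<phi> "cball 0 D" w z] inv w(1) unfolding w(3) by blast
    qed
    have "\<exists>A. is_attractor ?\<Phi> A \<and> X \<subseteq> A"
    proof (rule attractor_contains_self_covered_set[OF _ contr _ _ _ _ _ X_sub X_step])
      show "finite ?\<Phi>" by (simp add: family_at_def)
      show "hutchinson ?\<Phi> (cball 0 D) \<subseteq> cball 0 D"
        unfolding hutchinson_def family_at_def using inv by blast
      show "X \<noteq> {}" using ball_X R by auto
    qed (use s in auto)
    then obtain A where A: "is_attractor ?\<Phi> A" "X \<subseteq> A" by blast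
    have "ball q\<^sub>0 R \<subseteq> interior A" using ball_X A by (intro interior_maximal) auto
    moreover have "q\<^sub>0 \<in> ball q\<^sub>0 R" using R by simp
    ultimately have "interior A \<noteq> {}" by blast
    with A(1) show "\<exists>A. is_attractor ?\<Phi> A \<and> interior A \<noteq> {}" by blast
  qed
qed

end
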